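(* Let $G$ be an infinite totally bounded topological group of cardinality $\gamma$, let $H$ be a subgroup of $G$ such that $|G:H|=\gamma$, and let $F$ be a finite subset of $G$. Then the following statements hold: (i) there is a subset $B$ dense in $G$ such that the product $FB$ is a partial factorization, i.e. $gB\cap hB=\emptyset$ for all distinct $g,h\in F$; (ii) there is a subset $R$ dense in $G$ such that $G=HR$ is a factorization, i.e. $G=HR$ and $hR\cap h'R=\emptyset$ for all distinct $h,h'\in H$. In particular, every infinite totally bounded topological group $G$ of cardinality $\gamma$ is partially box $n$-resolvable for each $n\in\mathbb{N}$, and is box $\kappa$-resolvable for each infinite cardinal $\kappa$ with $\kappa<\gamma$.
   Context: A topological group $G$ is totally bounded if for every neighborhood $U$ of the identity there is a finite subset $K\subseteq G$ with $G=KU$. For subsets $A,B$ of a group $G$, $AB=\{ab: a\in A, b\in B\}$ and $aB=\{ab:b\in B\}$. The product $AB$ is a partial factorization if $aB\cap a'B=\emptyset$ for any distinct $a,a'\in A$; if in addition $G=AB$, it is a factorization of $G$. For a cardinal $\kappa$, a topological group $G$ is partially box $\kappa$-resolvable if there exist a dense subset $B$ of $G$ and a subset $A\subseteq G$ with $|A|=\kappa$ such that the subsets $aB$, $a\in A$, are pairwise disjoint; $G$ is box $\kappa$-resolvable if $A,B$ can be chosen so that moreover $G=AB$. $|G:H|$ denotes the index of the subgroup $H$ in $G$ (the cardinality of the set of cosets). *)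

theory Defs
  imports "HOL-Algebra.Coset" "HOL-Analysis.Product_Topology" "HOL-Library.Disjoint_Sets"
begin

unbundle cardinal_syntax

text \<open>No separation axiom is part of the definition: the topology need not be Hausdorff.\<close>

locale topological_group = group G for G (structure) +
  fixes T :: "'a topology"
  assumes topspace_eq_carrier: "topspace T = carrier G"
    and continuous_mult: "continuous_map (prod_topology T T) T (\<lambda>(x, y). x \<otimes> y)"
    and continuous_inv: "continuous_map T T (\<lambda>x. inv x)"

definition totally_bounded_group :: "('a, 'b) monoid_scheme \<Rightarrow> 'a topology \<Rightarrow> bool" where
  "totally_bounded_group G T \<longleftrightarrow>
    (\<forall>U. U \<subseteq> carrier G \<and> \<one>\<^bsub>G\<^esub> \<in> T interior_of U \<longrightarrow>
      (\<exists>K. finite K \<and> K \<subseteq> carrier G \<and> carrier G = K <#>\<^bsub>G\<^esub> U))"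

definition dense_subset :: "'a topology \<Rightarrow> 'a set \<Rightarrow> bool" where
  "dense_subset T B \<longleftrightarrow> B \<subseteq> topspace T \<and> T closure_of B = topspace T"

definition partial_factorization :: "('a, 'b) monoid_scheme \<Rightarrow> 'a set \<Rightarrow> 'a set \<Rightarrow> bool" where
  "partial_factorization G A B \<longleftrightarrow>
    A \<subseteq> carrier G \<and> B \<subseteq> carrier G \<and> disjoint_family_on (\<lambda>a. a <#\<^bsub>G\<^esub> B) A"

definition factorization :: "('a, 'b) monoid_scheme \<Rightarrow> 'a set \<Rightarrow> 'a set \<Rightarrow> bool" where
  "factorization G A B \<longleftrightarrow> partial_factorization G A B \<and> carrier G = A <#>\<^bsub>G\<^esub> B"

text \<open>
  In the following two definitions the cardinal \<open>\<kappa>\<close> is a cardinal well-order on an arbitrary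
  type, unrelated to the type of the group elements.
\<close>

definition partially_box_resolvable ::
    "('a, 'b) monoid_scheme \<Rightarrow> 'a topology \<Rightarrow> 'k rel \<Rightarrow> bool" where
  "partially_box_resolvable G T \<kappa> \<longleftrightarrow>
    (\<exists>A B. |A| =o \<kappa> \<and> dense_subset T B \<and> partial_factorization G A B)"

definition box_resolvable ::
    "('a, 'b) monoid_scheme \<Rightarrow> 'a topology \<Rightarrow> 'k rel \<Rightarrow> bool" where
  "box_resolvable G T \<kappa> \<longleftrightarrow>
    (\<exists>A B. |A| =o \<kappa> \<and> dense_subset T B \<and> factorization G A B)"

end

theory Submission
  imports Defs
begin

text \<open>
  Write \<open>\<gamma>\<close> for the cardinality of the group \<open>G\<close>. Both factorizations ask for a dense set \<open>B\<close>
  which is separated: \<open>b c\<inverse> \<notin> E\<close> for distinct \<open>b, c \<in> B\<close>. Here \<open>E = F\<inverse>F\<close> for a partial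
  factorization \<open>FB\<close>, and \<open>E = H\<close> for a set \<open>B\<close> that meets each right coset of \<open>H\<close> at most once;
  adding points of the missed cosets then turns \<open>B\<close> into a transversal.

  A topology on \<open>G\<close> may have more than \<open>\<gamma>\<close> open sets, so a recursion over the open sets
  could run out of room. Total boundedness provides a substitute for them with only \<open>\<gamma>\<close>
  tasks. Let \<open>W\<close> be an open neighbourhood of \<open>g\<close> and choose a neighbourhood \<open>V\<close> of the identity
  with \<open>V\<inverse>Vg \<subseteq> W\<close>. If \<open>G\<close> is a union of \<open>n\<close> left translates of \<open>V\<close>, then two of any
  \<open>n + 1\<close> points \<open>x\<^sub>0, \<dots>, x\<^sub>n\<close> lie in the same translate, so \<open>x\<^sub>i\<inverse>x\<^sub>jg \<in> W\<close> for some
  \<open>i < j\<close>. Hence \<open>B\<close> is dense as soon as, for every \<open>g\<close> and \<open>n\<close>, it contains all the points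
  \<open>x\<^sub>i\<inverse>x\<^sub>jg\<close> (\<open>i < j \<le> n\<close>) for some \<open>x\<^sub>0, \<dots>, x\<^sub>n\<close> (lemma
  \<open>dense_of_quotient_patterns\<close>).

  There are \<open>\<gamma>\<close> pairs \<open>(g, n)\<close>. A transfinite recursion treats them one at a time, adding finitely
  many points each time, so that fewer than \<open>\<gamma>\<close> points precede each stage (lemma
  \<open>separated_set_with_quotient_patterns\<close>). What a stage needs is that the sets forbidden for
  the next \<open>x\<^sub>j\<close>, which have the form \<open>a\<inverse>Ey\<close> with finitely many \<open>a\<close> and fewer than
  \<open>\<gamma>\<close> elements \<open>y\<close>, do not cover \<open>G\<close>. Such sets \<open>E\<close> are called slender below. Sets with
  fewer than \<open>\<gamma>\<close> elements are slender by counting, and subgroups of index \<open>\<gamma>\<close> are slender by an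
  argument in the style of B. H. Neumann's theorem on coverings by cosets. The first case also
  gives the statement on infinite \<open>\<kappa> < \<gamma>\<close>, by means of a subgroup of cardinality
  \<open>\<kappa>\<close>.
\<close>

section \<open>Cardinal arithmetic\<close>

lemma card_of_finite_ordLess_infinite:
  "finite A \<Longrightarrow> infinite B \<Longrightarrow> |A| <o |B|"
  using card_of_ordLeq_finite not_ordLeq_iff_ordLess [OF card_of_Well_order card_of_Well_order]
  by blast

lemma card_of_image_ordLess: "|A| <o r \<Longrightarrow> |f ` A| <o r"
  using card_of_image by (rule ordLeq_ordLess_trans)

lemma card_of_Times_ordLess:
  assumes "infinite C" "|A| <o |C|" "|B| <o |C|"
  shows "|A \<times> B| <o |C|"
proof (cases "finite (A <+> B)")
  case True
  then have "finite A" "finite B"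
    by (simp_all add: finite_Plus_iff)
  then show ?thesis
    using assms by (intro card_of_finite_ordLess_infinite) auto
next
  case False
  have "|A \<times> B| \<le>o |(A <+> B) \<times> (A <+> B)|"
    by (intro card_of_ordLeqI [of "\<lambda>(a, b). (Inl a, Inr b)"]) (auto simp: inj_on_def)
  also have "|(A <+> B) \<times> (A <+> B)| =o |A <+> B|"
    using False by (intro card_of_Times_same_infinite) simp
  also have "|A <+> B| <o |C|"
    using assms by (rule card_of_Plus_ordLess_infinite)
  finally show ?thesis .
qed

text \<open>
  The union is finite or at most as large as the index set, so the bound holds even if the
  cardinal of \<open>C\<close> is singular.
\<close>

lemma card_of_UNION_finite_ordLess:
  assumes "infinite C" "|I| <o |C|" "\<And>i. i \<in> I \<Longrightarrow> finite (f i)"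
  shows "|\<Union>i\<in>I. f i| <o |C|"
proof (cases "finite I")
  case True
  then show ?thesis
    using assms by (intro card_of_finite_ordLess_infinite) auto
next
  case False
  then have "|\<Union>i\<in>I. f i| \<le>o |I|"
    using assms(3)
    by (intro card_of_UNION_ordLeq_infinite)
      (auto intro: ordLess_imp_ordLeq card_of_finite_ordLess_infinite card_of_mono1)
  then show ?thesis
    using assms(2) ordLeq_ordLess_trans by blast
qed

context group
begin

lemma inv_mult_cancel [simp]:
  assumes "x \<in> carrier G" "y \<in> carrier G"
  shows "inv x \<otimes> (x \<otimes> y) = y" "x \<otimes> (inv x \<otimes> y) = y"
  using assms by (simp_all add: m_assoc [symmetric])

section \<open>Slender sets\<close>

text \<open>
  The condition \<open>a z y\<inverse> \<notin> E\<close> says that \<open>z\<close> lies outside \<open>a\<inverse>Ey\<close>; a slender set is thus one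
  that fails to cover the group by a family of translates \<open>a\<inverse>Ey\<close> with finitely many left
  and fewer than \<open>|G|\<close> right factors.
\<close>

definition slender :: "'a set \<Rightarrow> bool" where
  "slender E \<longleftrightarrow> (\<forall>A Y. finite A \<and> A \<subseteq> carrier G \<and> Y \<subseteq> carrier G \<and> |Y| <o |carrier G| \<longrightarrow>
    (\<exists>z\<in>carrier G. \<forall>a\<in>A. \<forall>y\<in>Y. a \<otimes> z \<otimes> inv y \<notin> E))"

lemma slender_of_card_less:
  assumes inf: "infinite (carrier G)" and "E \<subseteq> carrier G" and "|E| <o |carrier G|"
  shows "slender E"
  unfolding slender_def
proof (intro allI impI, elim conjE)
  fix A Y
  assume A: "finite A" "A \<subseteq> carrier G" and Y: "Y \<subseteq> carrier G" "|Y| <o |carrier G|"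
  define S where "S = (\<lambda>(a, e, y). inv a \<otimes> e \<otimes> y) ` (A \<times> E \<times> Y)"
  have "|A \<times> E \<times> Y| <o |carrier G|"
    using A Y assms by (simp add: card_of_Times_ordLess card_of_finite_ordLess_infinite)
  then have "|S| <o |carrier G|"
    unfolding S_def by (rule card_of_image_ordLess)
  then have "\<not> carrier G \<subseteq> S"
    using card_of_mono1 not_ordLess_ordLeq by blast
  then obtain z where z: "z \<in> carrier G" "z \<notin> S"
    by blast
  have "a \<otimes> z \<otimes> inv y \<notin> E" if "a \<in> A" "y \<in> Y" for a y
  proof
    assume e: "a \<otimes> z \<otimes> inv y \<in> E"
    have "a \<in> carrier G" "y \<in> carrier G"
      using that A Y by auto
    then have "inv a \<otimes> (a \<otimes> z \<otimes> inv y) \<otimes> y = z"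
      using z by (simp add: m_assoc)
    then have "z \<in> S"
      unfolding S_def using that e by force
    with z show False
      by simp
  qed
  then show "\<exists>z\<in>carrier G. \<forall>a\<in>A. \<forall>y\<in>Y. a \<otimes> z \<otimes> inv y \<notin> E"
    using z by blast
qed

lemma mem_rcoset_iff:
  assumes "subgroup H G" "x \<in> carrier G"
  shows "y \<in> H #> x \<longleftrightarrow> y \<in> carrier G \<and> y \<otimes> inv x \<in> H"
proof -
  have "y = h \<otimes> x \<Longrightarrow> h \<in> H \<Longrightarrow> y \<in> carrier G \<and> y \<otimes> inv x \<in> H" for h
    using assms by (simp add: m_assoc subgroup.mem_carrier)
  moreover have "y \<in> carrier G \<Longrightarrow> y = (y \<otimes> inv x) \<otimes> x"
    using assms by (simp add: m_assoc)
  ultimately show ?thesis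
    unfolding r_coset_def by blast
qed

text \<open>
  The proof adds the left factors one at a time. A right translate of a point \<open>z\<close> that is good
  for the old left factors stays good for them if \<open>Y\<close> is enlarged beforehand, and one such
  translate also works for the new factor \<open>a\<close>: if \<open>az\<close> falls into a coset \<open>Hp\<close> with
  \<open>p \<in> Y\<close>, then right multiplication by \<open>p\<inverse>w\<close> moves it into a coset \<open>Hw\<close> that contains no
  element of \<open>Y\<close>. As \<open>Y\<close> represents fewer cosets than the index, such a \<open>w\<close> exists.
\<close>

lemma slender_subgroup:
  assumes inf: "infinite (carrier G)" and H: "subgroup H G"
    and index: "|rcosets H| =o |carrier G|"
  shows "slender H"
proof -
  have escape: "\<exists>w\<in>carrier G. \<forall>y\<in>Y. w \<otimes> inv y \<notin> H"
    if Y: "Y \<subseteq> carrier G" "|Y| <o |carrier G|" for Y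
  proof (rule ccontr)
    assume "\<not> ?thesis"
    then have meet: "\<forall>w\<in>carrier G. \<exists>y\<in>Y. w \<in> H #> y"
      using Y by (auto simp: mem_rcoset_iff [OF H] subset_iff)
    have "rcosets H \<subseteq> (\<lambda>y. H #> y) ` Y"
    proof
      fix C assume "C \<in> rcosets H"
      then obtain w where w: "w \<in> carrier G" "C = H #> w"
        unfolding RCOSETS_def by blast
      with meet obtain y where "y \<in> Y" "w \<in> H #> y"
        by blast
      then show "C \<in> (\<lambda>y. H #> y) ` Y"
        using w repr_independence [OF _ _ H, of w y] Y by blast
    qed
    then have "|rcosets H| \<le>o |Y|"
      by (rule ordLeq_transitive [OF card_of_mono1 card_of_image])
    then have "|carrier G| \<le>o |Y|"
      by (rule ordIso_ordLeq_trans [OF ordIso_symmetric [OF index]])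
    with Y(2) show False
      using not_ordLess_ordLeq by blast
  qed
  have "\<exists>z\<in>carrier G. \<forall>a\<in>A. \<forall>y\<in>Y. a \<otimes> z \<otimes> inv y \<notin> H"
    if "finite A" "A \<subseteq> carrier G" "Y \<subseteq> carrier G" "|Y| <o |carrier G|" for A Y
    using that
  proof (induction A arbitrary: Y)
    case empty
    then show ?case by auto
  next
    case (insert a A)
    then have a: "a \<in> carrier G" and A: "A \<subseteq> carrier G"
      by auto
    obtain w where w: "w \<in> carrier G" "\<forall>y\<in>Y. w \<otimes> inv y \<notin> H"
      using escape [OF insert.prems(2,3)] by blast
    \<comment> \<open>The products make the induction hypothesis survive the passage from \<open>z\<close> to \<open>z p\<inverse> w\<close>.\<close>
    define Y' where "Y' = Y \<union> (\<lambda>(p, q). p \<otimes> inv w \<otimes> q) ` (Y \<times> Y)"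
    have "|(\<lambda>(p, q). p \<otimes> inv w \<otimes> q) ` (Y \<times> Y)| <o |carrier G|"
      using inf insert.prems by (intro card_of_image_ordLess card_of_Times_ordLess)
    then have "|Y'| <o |carrier G|"
      unfolding Y'_def using inf insert.prems by (intro card_of_Un_ordLess_infinite)
    moreover have "Y' \<subseteq> carrier G"
      unfolding Y'_def using insert.prems w by auto
    ultimately obtain z where z: "z \<in> carrier G" "\<forall>a\<in>A. \<forall>y\<in>Y'. a \<otimes> z \<otimes> inv y \<notin> H"
      using insert.IH [OF A, of Y'] by blast
    show ?case
    proof (cases "\<forall>y\<in>Y. a \<otimes> z \<otimes> inv y \<notin> H")
      case True
      then show ?thesis
        using z unfolding Y'_def by blast
    next
      case False
      then obtain p where p: "p \<in> Y" "a \<otimes> z \<otimes> inv p \<in> H"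
        by blast
      then have pc: "p \<in> carrier G"
        using insert.prems by auto
      define h where "h = a \<otimes> z \<otimes> inv p"
      have h: "h \<in> H" "h \<in> carrier G"
        unfolding h_def using p a z pc by auto
      define z' where "z' = z \<otimes> inv p \<otimes> w"
      have z': "z' \<in> carrier G"
        unfolding z'_def using z w pc by simp
      have "a \<otimes> z' \<otimes> inv y \<notin> H" if "y \<in> Y" for y
      proof
        assume "a \<otimes> z' \<otimes> inv y \<in> H"
        moreover have y: "y \<in> carrier G"
          using that insert.prems by auto
        have "a \<otimes> z' \<otimes> inv y = h \<otimes> (w \<otimes> inv y)"
          unfolding z'_def h_def using a z w pc y by (simp add: m_assoc)
        ultimately have "inv h \<otimes> (h \<otimes> (w \<otimes> inv y)) \<in> H"
          using h H by (simp add: subgroup.m_closed subgroup.m_inv_closed)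
        then have "w \<otimes> inv y \<in> H"
          using h w y by simp
        with w that show False
          by blast
      qed
      moreover have "b \<otimes> z' \<otimes> inv y \<notin> H" if "b \<in> A" "y \<in> Y" for b y
      proof -
        have bc: "b \<in> carrier G" "y \<in> carrier G"
          using that A insert.prems by auto
        have "b \<otimes> z' \<otimes> inv y = b \<otimes> z \<otimes> inv (y \<otimes> inv w \<otimes> p)"
          unfolding z'_def using bc z w pc by (simp add: m_assoc inv_mult_group)
        moreover have "y \<otimes> inv w \<otimes> p \<in> Y'"
          unfolding Y'_def using that p by force
        ultimately show ?thesis
          using z that by simp
      qed
      ultimately show ?thesis
        using z' by blast
    qed
  qed
  then show ?thesis
    unfolding slender_def by blast
qed

section \<open>Separated sets with many quotients\<close>

definition quotient_pattern :: "(nat \<Rightarrow> 'a) \<Rightarrow> 'a \<Rightarrow> nat \<Rightarrow> 'a set" where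
  "quotient_pattern x g n = {inv (x i) \<otimes> x j \<otimes> g | i j. i < j \<and> j \<le> n}"

lemma finite_quotient_pattern: "finite (quotient_pattern x g n)"
proof -
  have "quotient_pattern x g n \<subseteq> (\<lambda>(i, j). inv (x i) \<otimes> x j \<otimes> g) ` ({..n} \<times> {..n})"
    unfolding quotient_pattern_def by force
  then show ?thesis
    by (rule finite_subset) auto
qed

lemma quotient_pattern_subset:
  "x \<in> {..n} \<rightarrow> carrier G \<Longrightarrow> g \<in> carrier G \<Longrightarrow> quotient_pattern x g n \<subseteq> carrier G"
  unfolding quotient_pattern_def by (auto simp: Pi_iff)

lemma quotient_pattern_extend:
  "quotient_pattern (x(Suc n := z)) g (Suc n) =
    quotient_pattern x g n \<union> (\<lambda>i. inv (x i) \<otimes> z \<otimes> g) ` {..n}"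
  (is "?L = ?D \<union> ?N")
proof (intro equalityI subsetI)
  fix b assume "b \<in> ?L"
  then obtain i j where ij: "i < j" "j \<le> Suc n"
    "b = inv ((x(Suc n := z)) i) \<otimes> (x(Suc n := z)) j \<otimes> g"
    unfolding quotient_pattern_def by blast
  show "b \<in> ?D \<union> ?N"
  proof (cases "j = Suc n")
    case True
    then show ?thesis
      using ij by auto
  next
    case False
    then have "j \<le> n" "b = inv (x i) \<otimes> x j \<otimes> g"
      using ij by auto
    then show ?thesis
      unfolding quotient_pattern_def using ij(1) by blast
  qed
next
  have mem: "inv ((x(Suc n := z)) i) \<otimes> (x(Suc n := z)) j \<otimes> g \<in> ?L"
    if "i < j" "j \<le> Suc n" for i j
    unfolding quotient_pattern_def using that by blast
  fix b assume "b \<in> ?D \<union> ?N"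
  then consider i j where "i < j" "j \<le> n" "b = inv (x i) \<otimes> x j \<otimes> g"
    | i where "i \<le> n" "b = inv (x i) \<otimes> z \<otimes> g"
    unfolding quotient_pattern_def by blast
  then show "b \<in> ?L"
  proof cases
    case (1 i j)
    then show ?thesis
      using mem [of i j] by simp
  next
    case (2 i)
    then show ?thesis
      using mem [of i "Suc n"] by simp
  qed
qed

text \<open>
  One stage of the recursion, with \<open>Y\<close> holding the points chosen earlier. The elements
  \<open>x\<^sub>i\<close> are found one after another. For the new element \<open>z\<close>, slenderness separates the new points
  \<open>x\<^sub>i\<inverse>zg\<close> from \<open>Y\<close> and from the old points. Two new points need no choice:
  their quotient is \<open>x\<^sub>i\<inverse>x\<^sub>j\<close>, which is the quotient of the old point \<open>x\<^sub>i\<inverse>x\<^sub>jg\<close>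
  by \<open>g\<close>. This is why \<open>g\<close> itself has to be one of the points to be avoided.
\<close>

lemma fresh_quotient_pattern:
  assumes inf: "infinite (carrier G)" and E: "slender E"
    and sym: "\<And>e. e \<in> E \<Longrightarrow> e \<in> carrier G \<Longrightarrow> inv e \<in> E"
    and Y: "Y \<subseteq> carrier G" "|Y| <o |carrier G|" and g: "g \<in> Y"
  shows "\<exists>x \<in> {..n} \<rightarrow> carrier G.
    pairwise (\<lambda>b c. b \<otimes> inv c \<notin> E) (quotient_pattern x g n) \<and>
    (\<forall>b\<in>quotient_pattern x g n. \<forall>y\<in>Y. b \<otimes> inv y \<notin> E)"
proof (induction n)
  case 0
  show ?case
    by (rule bexI [of _ "\<lambda>_. \<one>"]) (auto simp: quotient_pattern_def)
next
  case (Suc n)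
  then obtain x where x: "x \<in> {..n} \<rightarrow> carrier G"
    and sep: "pairwise (\<lambda>b c. b \<otimes> inv c \<notin> E) (quotient_pattern x g n)"
    and fresh: "\<And>b y. b \<in> quotient_pattern x g n \<Longrightarrow> y \<in> Y \<Longrightarrow> b \<otimes> inv y \<notin> E"
    by blast
  let ?D = "quotient_pattern x g n"
  have gc: "g \<in> carrier G"
    using g Y by auto
  have xc: "x i \<in> carrier G" if "i \<le> n" for i
    using x that by auto
  have D: "?D \<subseteq> carrier G"
    using quotient_pattern_subset x gc by blast
  let ?A = "(\<lambda>i. inv (x i)) ` {..n}" and ?Y = "(\<lambda>y. y \<otimes> inv g) ` (Y \<union> ?D)"
  have "|Y \<union> ?D| <o |carrier G|"
    by (intro card_of_Un_ordLess_infinite card_of_finite_ordLess_infinite inf Y(2)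
        finite_quotient_pattern)
  then have "|?Y| <o |carrier G|"
    by (rule card_of_image_ordLess)
  moreover have "?Y \<subseteq> carrier G"
    using Y D gc by auto
  moreover have "finite ?A" "?A \<subseteq> carrier G"
    using xc by auto
  ultimately obtain z where z: "z \<in> carrier G" "\<forall>a\<in>?A. \<forall>y\<in>?Y. a \<otimes> z \<otimes> inv y \<notin> E"
    using E [unfolded slender_def, rule_format, of ?A ?Y] by blast
  let ?new = "\<lambda>i. inv (x i) \<otimes> z \<otimes> g"
  have new: "?new i \<otimes> inv y \<notin> E" if "i \<le> n" "y \<in> Y \<union> ?D" for i y
  proof -
    have "y \<in> carrier G"
      using that Y D by blast
    then have "?new i \<otimes> inv y = inv (x i) \<otimes> z \<otimes> inv (y \<otimes> inv g)"
      using xc that z gc by (simp add: m_assoc inv_mult_group)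
    then show ?thesis
      using z that by auto
  qed
  have flip: "c \<otimes> inv b \<notin> E"
    if "b \<otimes> inv c \<notin> E" "b \<in> carrier G" "c \<in> carrier G" for b c
    using that sym [of "c \<otimes> inv b"] by (auto simp: inv_mult_group)
  have new_new_less: "?new i \<otimes> inv (?new j) \<notin> E" if "i < j" "j \<le> n" for i j
  proof -
    have "?new i \<otimes> inv (?new j) = (inv (x i) \<otimes> x j \<otimes> g) \<otimes> inv g"
      using xc that z gc by (simp add: m_assoc inv_mult_group)
    moreover have "inv (x i) \<otimes> x j \<otimes> g \<in> ?D"
      unfolding quotient_pattern_def using that by blast
    ultimately show ?thesis
      using fresh g by simp
  qed
  have newc: "?new i \<in> carrier G" if "i \<le> n" for i
    using xc that z gc by simp
  have new_new: "?new i \<otimes> inv (?new j) \<notin> E" if "?new i \<noteq> ?new j" "i \<le> n" "j \<le> n" for i j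
    using that new_new_less newc flip
    by (metis linorder_neqE_nat)
  have "pairwise (\<lambda>b c. b \<otimes> inv c \<notin> E) (?D \<union> ?new ` {..n})"
    unfolding pairwise_def
  proof (intro ballI impI)
    fix b c assume bc: "b \<in> ?D \<union> ?new ` {..n}" "c \<in> ?D \<union> ?new ` {..n}" "b \<noteq> c"
    consider "b \<in> ?D" "c \<in> ?D" | i where "i \<le> n" "b = ?new i" "c \<in> ?D"
      | i where "i \<le> n" "c = ?new i" "b \<in> ?D"
      | i j where "i \<le> n" "j \<le> n" "b = ?new i" "c = ?new j"
      using bc by blast
    then show "b \<otimes> inv c \<notin> E"
    proof cases
      case 1
      then show ?thesis using sep bc by (auto simp: pairwise_def)
    next
      case 2
      then show ?thesis using new by blast
    next
      case 3
      then show ?thesis using new flip newc D by blast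
    next
      case 4
      then show ?thesis using new_new bc by blast
    qed
  qed
  moreover have "\<forall>b\<in>?D \<union> ?new ` {..n}. \<forall>y\<in>Y. b \<otimes> inv y \<notin> E"
    using fresh new by blast
  moreover have "x(Suc n := z) \<in> {..Suc n} \<rightarrow> carrier G"
    using xc z by (auto simp: le_Suc_eq)
  ultimately show ?case
    using quotient_pattern_extend [of x n z g] by metis
qed

text \<open>
  The pairs \<open>(g, n)\<close> are well-ordered in the order type of the cardinal \<open>|G|\<close>, so each stage has
  fewer than \<open>|G|\<close> predecessors. Separation only has to be arranged towards earlier stages,
  since \<open>E\<close> is closed under inverses.
\<close>

lemma separated_set_with_quotient_patterns:
  assumes inf: "infinite (carrier G)" and E: "slender E"
    and sym: "\<And>e. e \<in> E \<Longrightarrow> e \<in> carrier G \<Longrightarrow> inv e \<in> E"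
  obtains B where "B \<subseteq> carrier G" "pairwise (\<lambda>b c. b \<otimes> inv c \<notin> E) B"
    "\<And>g n. g \<in> carrier G \<Longrightarrow> \<exists>x \<in> {..n} \<rightarrow> carrier G. quotient_pattern x g n \<subseteq> B"
proof -
  define I :: "('a \<times> nat) set" where "I = carrier G \<times> UNIV"
  define r where "r = |I|"
  define R where "R = r - Id"
  have wo: "Well_order r" and FI: "Field r = I" and co: "Card_order r"
    unfolding r_def by (rule card_of_Well_order Field_card_of card_of_Card_order)+
  have "|I| =o |carrier G|"
    unfolding I_def using inf
    by (intro card_of_Times_infinite_simps) (simp_all add: infinite_iff_card_of_nat [symmetric])
  then have segment: "|{j. (j, i) \<in> R}| <o |carrier G|" if "i \<in> I" for i
  proof -
    have "{j. (j, i) \<in> R} = underS r i"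
      unfolding R_def underS_def by auto
    moreover have "|underS r i| <o r"
      using card_of_underS [OF co] that FI by simp
    ultimately show ?thesis
      using ordLess_ordIso_trans [OF _ \<open>|I| =o |carrier G|\<close>] unfolding r_def by simp
  qed
  \<comment> \<open>\<open>D\<close> is an admissible choice at stage \<open>i\<close> after the choices \<open>f\<close>; indices outside \<open>I\<close>, which
    the choice principle ranges over too, carry no condition.\<close>
  define P where "P f i D \<longleftrightarrow> (i \<in> I \<longrightarrow>
      (\<exists>x \<in> {..snd i} \<rightarrow> carrier G. D = quotient_pattern x (fst i) (snd i)) \<and>
      pairwise (\<lambda>b c. b \<otimes> inv c \<notin> E) D \<and>
      (\<forall>b\<in>D. \<forall>j. (j, i) \<in> R \<longrightarrow> (\<forall>c\<in>f j. b \<otimes> inv c \<notin> E)))" for f i D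
  have PI: "finite D \<and> D \<subseteq> carrier G" if PD: "P f i D" and i: "i \<in> I" for f i D
  proof -
    have "fst i \<in> carrier G"
      using i unfolding I_def by auto
    moreover obtain x where "x \<in> {..snd i} \<rightarrow> carrier G" "D = quotient_pattern x (fst i) (snd i)"
      using PD i unfolding P_def by blast
    ultimately show ?thesis
      using quotient_pattern_subset finite_quotient_pattern by simp
  qed
  have RI: "j \<in> I" if "(j, i) \<in> R" for i j
    using that FI unfolding R_def by (metis DiffE FieldI1)
  have "\<exists>f. \<forall>i. P f i (f i)"
  proof (rule dependent_wf_choice)
    show "wf R"
      using wo unfolding R_def well_order_on_def by blast
    show "P f i D = P g i D" if "\<And>j. (j, i) \<in> R \<Longrightarrow> f j = g j" for f g i D
      unfolding P_def using that by auto
    show "\<exists>D. P f i D" if prev: "\<And>j. (j, i) \<in> R \<Longrightarrow> P f j (f j)" for i f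
    proof (cases "i \<in> I")
      case True
      then have g: "fst i \<in> carrier G"
        unfolding I_def by auto
      define Y where "Y = insert (fst i) (\<Union>j\<in>{j. (j, i) \<in> R}. f j)"
      have fin: "finite (f j)" "f j \<subseteq> carrier G" if "(j, i) \<in> R" for j
        using PI prev RI that by blast+
      have "|\<Union>j\<in>{j. (j, i) \<in> R}. f j| <o |carrier G|"
        using segment [OF True] inf fin by (intro card_of_UNION_finite_ordLess) auto
      then have "|{fst i} \<union> (\<Union>j\<in>{j. (j, i) \<in> R}. f j)| <o |carrier G|"
        by (intro card_of_Un_ordLess_infinite [OF inf card_of_finite_ordLess_infinite [OF _ inf]]) simp
      then have "|Y| <o |carrier G|"
        unfolding Y_def by simp
      moreover have "Y \<subseteq> carrier G" "fst i \<in> Y"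
        unfolding Y_def using g fin(2) by (blast, simp)
      ultimately obtain x where x: "x \<in> {..snd i} \<rightarrow> carrier G"
        "pairwise (\<lambda>b c. b \<otimes> inv c \<notin> E) (quotient_pattern x (fst i) (snd i))"
        "\<forall>b\<in>quotient_pattern x (fst i) (snd i). \<forall>y\<in>Y. b \<otimes> inv y \<notin> E"
        using fresh_quotient_pattern [OF inf E sym, of Y "fst i" "snd i"] by blast
      then have "P f i (quotient_pattern x (fst i) (snd i))"
        unfolding P_def Y_def by blast
      then show ?thesis ..
    next
      case False
      then show ?thesis
        unfolding P_def by blast
    qed
  qed
  then obtain f where f: "\<And>i. P f i (f i)"
    by blast
  define B where "B = (\<Union>i\<in>I. f i)"
  have Bc: "B \<subseteq> carrier G"
    unfolding B_def using PI f by blast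
  moreover have "pairwise (\<lambda>b c. b \<otimes> inv c \<notin> E) B"
    unfolding pairwise_def
  proof (intro ballI impI)
    fix b c assume bc: "b \<in> B" "c \<in> B" "b \<noteq> c"
    then obtain i j where ij: "i \<in> I" "j \<in> I" "b \<in> f i" "c \<in> f j"
      unfolding B_def by blast
    have later: "d \<otimes> inv e \<notin> E" if "(k, l) \<in> R" "d \<in> f l" "e \<in> f k" "l \<in> I" for d e k l
      using f [of l] that unfolding P_def by blast
    have "i = j \<or> (i, j) \<in> R \<or> (j, i) \<in> R"
      using wo ij FI unfolding R_def well_order_on_def linear_order_on_def total_on_def by blast
    then show "b \<otimes> inv c \<notin> E"
    proof (elim disjE)
      assume "i = j"
      then show ?thesis
        using f [of i] ij bc unfolding P_def pairwise_def by blast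
    next
      assume "(j, i) \<in> R"
      then show ?thesis
        using later ij by blast
    next
      assume "(i, j) \<in> R"
      then have "c \<otimes> inv b \<notin> E"
        using later ij by blast
      moreover have "b \<in> carrier G" "c \<in> carrier G"
        using bc Bc by auto
      ultimately show ?thesis
        using sym [of "b \<otimes> inv c"] by (auto simp: inv_mult_group)
    qed
  qed
  moreover have "\<exists>x \<in> {..n} \<rightarrow> carrier G. quotient_pattern x g n \<subseteq> B" if g: "g \<in> carrier G" for g n
  proof -
    have i: "(g, n) \<in> I"
      unfolding I_def using g by simp
    then obtain x where x: "x \<in> {..n} \<rightarrow> carrier G" "f (g, n) = quotient_pattern x g n"
      using f [of "(g, n)"] unfolding P_def by auto
    have "f (g, n) \<subseteq> B"
      unfolding B_def using i by blast
    then show ?thesis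
      using x by auto
  qed
  ultimately show thesis
    using that by blast
qed

section \<open>From separated sets to factorizations\<close>

lemma partial_factorization_of_separated:
  assumes "A \<subseteq> carrier G" "B \<subseteq> carrier G"
    and "pairwise (\<lambda>b c. b \<otimes> inv c \<notin> E) B"
    and "\<And>a a'. a \<in> A \<Longrightarrow> a' \<in> A \<Longrightarrow> inv a \<otimes> a' \<in> E"
  shows "partial_factorization G A B"
  unfolding partial_factorization_def disjoint_family_on_def
proof (intro conjI ballI impI assms)
  fix a a' assume a: "a \<in> A" "a' \<in> A" "a \<noteq> a'"
  show "(a <# B) \<inter> (a' <# B) = {}"
  proof (rule ccontr)
    assume "(a <# B) \<inter> (a' <# B) \<noteq> {}"
    then obtain b c where bc: "b \<in> B" "c \<in> B" "a \<otimes> b = a' \<otimes> c"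
      unfolding l_coset_def by auto
    have car: "a \<in> carrier G" "a' \<in> carrier G" "b \<in> carrier G" "c \<in> carrier G"
      using a bc assms by auto
    have "b \<otimes> inv c = inv a \<otimes> (a \<otimes> b) \<otimes> inv c"
      using car by simp
    also have "\<dots> = inv a \<otimes> a'"
      unfolding bc(3) using car by (simp add: m_assoc)
    finally have "b \<otimes> inv c \<in> E"
      using assms(4) a by simp
    then have "b = c"
      using assms(3) bc unfolding pairwise_def by blast
    then show False
      using bc car a by simp
  qed
qed

lemma transversal_extension:
  assumes H: "subgroup H G" and B: "B \<subseteq> carrier G"
    and sep: "pairwise (\<lambda>b c. b \<otimes> inv c \<notin> H) B"
  obtains R where "B \<subseteq> R" "R \<subseteq> carrier G" "factorization G H R"
proof -
  define rep where "rep C = (SOME x. x \<in> C \<and> (C \<inter> B \<noteq> {} \<longrightarrow> x \<in> B))" for C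
  have rep: "rep C \<in> C \<and> (C \<inter> B \<noteq> {} \<longrightarrow> rep C \<in> B)" if "C \<in> rcosets H" for C
    unfolding rep_def
    by (rule someI_ex) (use subgroup.rcosets_non_empty [OF H that] in blast)
  have Hc: "H \<subseteq> carrier G"
    using H by (rule subgroup.subset)
  define R where "R = rep ` (rcosets H)"
  have R: "R \<subseteq> carrier G"
    unfolding R_def using rep subgroup.rcosets_carrier [OF H is_group] by blast
  have "B \<subseteq> R"
  proof
    fix b assume b: "b \<in> B"
    then have bc: "b \<in> carrier G"
      using B by blast
    let ?C = "H #> b"
    have C: "?C \<in> rcosets H"
      using rcosetsI [OF Hc bc] .
    have "rep ?C \<in> ?C" "rep ?C \<in> B"
      using rep [OF C] b rcos_self [OF bc H] by auto
    then have "rep ?C = b"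
      using sep b mem_rcoset_iff [OF H bc] unfolding pairwise_def by blast
    then show "b \<in> R"
      unfolding R_def using C by (metis imageI)
  qed
  moreover have "pairwise (\<lambda>b c. b \<otimes> inv c \<notin> H) R"
    unfolding pairwise_def R_def
  proof (clarify)
    fix C D assume CD: "C \<in> rcosets H" "D \<in> rcosets H" "rep C \<noteq> rep D" "rep C \<otimes> inv rep D \<in> H"
    have coset: "X = H #> rep X" and car: "rep X \<in> carrier G" if X: "X \<in> rcosets H" for X
    proof -
      obtain x where x: "x \<in> carrier G" "X = H #> x"
        using X unfolding RCOSETS_def by blast
      then show "X = H #> rep X"
        using repr_independence [OF _ x(1) H] rep [OF X] by blast
      show "rep X \<in> carrier G"
        using X R unfolding R_def by blast
    qed
    have "rep C \<in> H #> rep D"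
      using CD car mem_rcoset_iff [OF H] by blast
    then have "C = D"
      using coset CD car repr_independence [OF _ _ H] by metis
    with CD show False
      by simp
  qed
  then have "partial_factorization G H R"
    using Hc R subgroup.m_closed [OF H] subgroup.m_inv_closed [OF H]
    by (intro partial_factorization_of_separated) auto
  moreover have "carrier G = H <#> R"
  proof
    show "H <#> R \<subseteq> carrier G"
      using Hc R unfolding set_mult_def by auto
    show "carrier G \<subseteq> H <#> R"
    proof
      fix x assume x: "x \<in> carrier G"
      let ?C = "H #> x"
      have C: "?C \<in> rcosets H"
        using rcosetsI [OF Hc x] .
      have "rep ?C \<otimes> inv x \<in> H" and r: "rep ?C \<in> carrier G"
        using rep [OF C] mem_rcoset_iff [OF H x] by blast+
      then have "inv (rep ?C \<otimes> inv x) \<in> H"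
        by (intro subgroup.m_inv_closed [OF H])
      moreover have "x = inv (rep ?C \<otimes> inv x) \<otimes> rep ?C"
        using x r by (simp add: inv_mult_group m_assoc)
      ultimately show "x \<in> H <#> R"
        unfolding set_mult_def R_def using C by blast
    qed
  qed
  ultimately show thesis
    using that R unfolding factorization_def by blast
qed

text \<open>
  The subgroup generated by \<open>A\<close>, built as the union of countably many stages so that its size
  can be read off: each stage consists of the quotients of elements of the previous one.
\<close>

lemma subgroup_of_infinite_cardinality:
  assumes "A \<subseteq> carrier G" "infinite A"
  obtains H where "subgroup H G" "|H| =o |A|"
proof -
  define S where "S = rec_nat (insert \<one> A) (\<lambda>_ X. (\<lambda>(a, b). a \<otimes> inv b) ` (X \<times> X))"
  have S0: "S 0 = insert \<one> A" and SS: "S (Suc n) = (\<lambda>(a, b). a \<otimes> inv b) ` (S n \<times> S n)" for n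
    unfolding S_def by auto
  have Sc: "S n \<subseteq> carrier G" for n
    by (induction n) (use assms in \<open>auto simp: S0 SS\<close>)
  have S1: "\<one> \<in> S n" for n
    by (induction n) (force simp: S0 SS)+
  have "S n \<subseteq> S (Suc n)" for n
  proof
    fix a assume "a \<in> S n"
    then show "a \<in> S (Suc n)"
      unfolding SS using Sc S1 by (intro image_eqI [of _ _ "(a, \<one>)"]) (auto simp: subset_iff)
  qed
  then have Smono: "S m \<subseteq> S n" if "m \<le> n" for m n
    using lift_Suc_mono_le that by blast
  have card: "|S n| \<le>o |A|" for n
  proof (induction n)
    case 0
    have "|{\<one>} <+> A| =o |A|"
      using assms(2)
      by (intro card_of_Plus_infinite2 ordLess_imp_ordLeq card_of_finite_ordLess_infinite) auto
    then have "|{\<one>} \<union> A| \<le>o |A|"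
      using card_of_Un_Plus_ordLeq ordLeq_ordIso_trans by blast
    then show ?case
      by (simp add: S0)
  next
    case (Suc n)
    have "|S n \<times> S n| \<le>o |A|"
      using assms(2)
      by (intro card_of_Times_ordLeq_infinite_Field Suc card_of_Card_order) (simp add: Field_card_of)
    then show ?case
      unfolding SS by (rule ordLeq_transitive [OF card_of_image])
  qed
  define H where "H = (\<Union>n. S n)"
  have quotient: "a \<otimes> inv b \<in> H" if ab: "a \<in> H" "b \<in> H" for a b
  proof -
    obtain m n where "a \<in> S m" "b \<in> S n"
      using ab unfolding H_def by blast
    then have "a \<in> S (max m n)" "b \<in> S (max m n)"
      using Smono by (meson max.cobounded1 max.cobounded2 subsetD)+
    then have "a \<otimes> inv b \<in> S (Suc (max m n))"
      unfolding SS by force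
    then show ?thesis
      unfolding H_def by blast
  qed
  have one: "\<one> \<in> H" and Hc: "H \<subseteq> carrier G"
    unfolding H_def using S1 Sc by auto
  have inv: "inv a \<in> H" if "a \<in> H" for a
    using quotient [OF one that] Hc that by auto
  have mult: "a \<otimes> b \<in> H" if "a \<in> H" "b \<in> H" for a b
    using quotient [OF that(1) inv [OF that(2)]] Hc that by auto
  have "subgroup H G"
    using one Hc inv mult by (intro subgroupI) auto
  moreover have "|H| \<le>o |A|"
    unfolding H_def using assms(2) card
    by (intro card_of_UNION_ordLeq_infinite) (auto simp: infinite_iff_card_of_nat)
  moreover have "A \<subseteq> H"
    unfolding H_def using S0 by blast
  ultimately show thesis
    using that [of H] card_of_mono1 [of A H] by (simp add: ordIso_iff_ordLeq)
qed

end

section \<open>Density in totally bounded groups\<close>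

context topological_group
begin

lemma quotient_neighbourhood:
  assumes W: "openin T W" and g: "g \<in> W"
  obtains V where "openin T V" "\<one> \<in> V" "\<And>v w. v \<in> V \<Longrightarrow> w \<in> V \<Longrightarrow> inv v \<otimes> w \<otimes> g \<in> W"
proof -
  have gc: "g \<in> topspace T"
    using openin_subset [OF W] g by blast
  have mult: "continuous_map X T (\<lambda>p. f p \<otimes> h p)"
    if "continuous_map X T f" "continuous_map X T h" for X :: "'c topology" and f h
    using continuous_map_compose [OF _ continuous_mult, of X "\<lambda>p. (f p, h p)"] that
    by (simp add: continuous_map_pairedI o_def)
  have "continuous_map (prod_topology T T) T (\<lambda>p. inv (fst p) \<otimes> snd p \<otimes> g)"
    using continuous_map_compose [OF continuous_map_fst continuous_inv, of T] gc
    by (intro mult continuous_map_snd) (auto simp: o_def)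
  then have "openin (prod_topology T T)
      {p \<in> topspace (prod_topology T T). inv (fst p) \<otimes> snd p \<otimes> g \<in> W}" (is "openin _ ?S")
    using W by (rule openin_continuous_map_preimage)
  moreover have "(\<one>, \<one>) \<in> ?S"
    using g gc topspace_eq_carrier by simp
  ultimately obtain V1 V2 where V: "openin T V1" "openin T V2" "\<one> \<in> V1" "\<one> \<in> V2" "V1 \<times> V2 \<subseteq> ?S"
    unfolding openin_prod_topology_alt by meson
  show thesis
  proof (rule that [of "V1 \<inter> V2"])
    show "inv v \<otimes> w \<otimes> g \<in> W" if "v \<in> V1 \<inter> V2" "w \<in> V1 \<inter> V2" for v w
      using that V(5) by force
  qed (use V in auto)
qed

text \<open>
  The pigeonhole argument: among \<open>card K + 1\<close> points two lie in the same translate \<open>kV\<close>, and the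
  factor \<open>k\<close> cancels in their quotient.
\<close>

lemma dense_of_quotient_patterns:
  assumes tb: "totally_bounded_group G T" and B: "B \<subseteq> carrier G"
    and pat: "\<And>g n. g \<in> carrier G \<Longrightarrow> \<exists>x \<in> {..n} \<rightarrow> carrier G. quotient_pattern x g n \<subseteq> B"
  shows "dense_subset T B"
  unfolding dense_subset_def dense_intersects_open
proof (intro conjI allI impI)
  show "B \<subseteq> topspace T"
    using B topspace_eq_carrier by simp
  fix W assume W: "openin T W \<and> W \<noteq> {}"
  then obtain g where g: "g \<in> W" "g \<in> carrier G"
    using openin_subset topspace_eq_carrier by (metis ex_in_conv subsetD)
  obtain V where V: "openin T V" "\<one> \<in> V" "\<And>v w. v \<in> V \<Longrightarrow> w \<in> V \<Longrightarrow> inv v \<otimes> w \<otimes> g \<in> W"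
    using quotient_neighbourhood [of W g] W g(1) by blast
  have Vc: "V \<subseteq> carrier G"
    using V openin_subset topspace_eq_carrier by metis
  have "\<one> \<in> T interior_of V"
    using V by (simp add: interior_of_openin)
  then obtain K where K: "finite K" "K \<subseteq> carrier G" "carrier G = K <#> V"
    using tb [unfolded totally_bounded_group_def, rule_format, of V] Vc by blast
  obtain x where x: "x \<in> {..card K} \<rightarrow> carrier G" "quotient_pattern x g (card K) \<subseteq> B"
    using pat g by blast
  have "\<forall>i\<in>{..card K}. \<exists>k\<in>K. \<exists>v\<in>V. x i = k \<otimes> v"
    using x(1) K(3) unfolding set_mult_def Pi_iff by blast
  then obtain k v where kv: "\<And>i. i \<le> card K \<Longrightarrow> k i \<in> K \<and> v i \<in> V \<and> x i = k i \<otimes> v i"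
    by (metis atMost_iff)
  have "k ` {..card K} \<subseteq> K"
    using kv by auto
  then have "\<not> inj_on k {..card K}"
    using K(1) card_inj_on_le [of k "{..card K}" K] by auto
  then obtain i j where ij: "i < j" "j \<le> card K" "k i = k j"
    unfolding inj_on_def by (metis atMost_iff linorder_neqE_nat)
  have car: "k j \<in> carrier G" "v i \<in> carrier G" "v j \<in> carrier G"
    using kv [of i] kv [of j] ij K Vc by auto
  have "inv (x i) \<otimes> x j \<otimes> g = inv (v i) \<otimes> v j \<otimes> g"
    using kv [of i] kv [of j] ij car g by (simp add: inv_mult_group m_assoc)
  then have "inv (x i) \<otimes> x j \<otimes> g \<in> W"
    using V kv ij by simp
  moreover have "inv (x i) \<otimes> x j \<otimes> g \<in> B"
    using x ij unfolding quotient_pattern_def by blast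
  ultimately show "B \<inter> W \<noteq> {}"
    by blast
qed

lemma dense_separated:
  assumes "totally_bounded_group G T" "infinite (carrier G)" "slender E"
    and "\<And>e. e \<in> E \<Longrightarrow> e \<in> carrier G \<Longrightarrow> inv e \<in> E"
  obtains B where "dense_subset T B" "B \<subseteq> carrier G" "pairwise (\<lambda>b c. b \<otimes> inv c \<notin> E) B"
  using separated_set_with_quotient_patterns [OF assms(2-4)] dense_of_quotient_patterns [OF assms(1)]
  by metis

section \<open>Resolvability\<close>

lemma dense_finite_partial_factorization:
  assumes "totally_bounded_group G T" "infinite (carrier G)" "finite F" "F \<subseteq> carrier G"
  obtains B where "dense_subset T B" "partial_factorization G F B"
proof -
  let ?E = "(\<lambda>(a, b). inv a \<otimes> b) ` (F \<times> F)"
  have "slender ?E"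
    using assms by (intro slender_of_card_less card_of_finite_ordLess_infinite) auto
  moreover have "inv e \<in> ?E" if e: "e \<in> ?E" for e
  proof -
    obtain a b where ab: "e = inv a \<otimes> b" "a \<in> F" "b \<in> F"
      using e by auto
    then have "inv e = inv b \<otimes> a"
      using assms(4) by (auto simp: inv_mult_group subset_iff)
    then show ?thesis
      using ab by force
  qed
  ultimately obtain B where B: "dense_subset T B" "B \<subseteq> carrier G"
    "pairwise (\<lambda>b c. b \<otimes> inv c \<notin> ?E) B"
    using dense_separated [OF assms(1,2)] by metis
  have "partial_factorization G F B"
    by (rule partial_factorization_of_separated [OF assms(4) B(2,3)]) auto
  then show thesis
    using that B by blast
qed

lemma dense_transversal:
  assumes "totally_bounded_group G T" "infinite (carrier G)" "subgroup H G" "slender H"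
  obtains R where "dense_subset T R" "factorization G H R"
proof -
  obtain B where B: "dense_subset T B" "B \<subseteq> carrier G" "pairwise (\<lambda>b c. b \<otimes> inv c \<notin> H) B"
    using dense_separated [OF assms(1,2,4)] subgroup.m_inv_closed [OF assms(3)] by metis
  obtain R where R: "B \<subseteq> R" "R \<subseteq> carrier G" "factorization G H R"
    using transversal_extension [OF assms(3) B(2,3)] by blast
  have "dense_subset T R"
    using B(1) R(1,2) closure_of_mono [of B R T] closure_of_subset_topspace [of T R]
    unfolding dense_subset_def topspace_eq_carrier by blast
  then show thesis
    using that R by blast
qed

end

theorem theorem2:
  fixes G :: "('a, 'b) monoid_scheme" and T :: "'a topology"
  assumes "topological_group G T"
    and "totally_bounded_group G T"
    and "infinite (carrier G)"
  shows "(\<forall>H F. subgroup H G \<and> |rcosets\<^bsub>G\<^esub> H| =o |carrier G| \<and> finite F \<and> F \<subseteq> carrier G \<longrightarrow>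
            (\<exists>B. dense_subset T B \<and> partial_factorization G F B) \<and>
            (\<exists>R. dense_subset T R \<and> factorization G H R)) \<and>
         (\<forall>n::nat. partially_box_resolvable G T |{..<n}| ) \<and>
         (\<forall>\<kappa> :: 'k rel. Card_order \<kappa> \<and> cinfinite \<kappa> \<and> \<kappa> <o |carrier G| \<longrightarrow> box_resolvable G T \<kappa>)"
proof -
  interpret topological_group G T
    by fact
  note tb = assms(2) and inf = assms(3)
  have "\<exists>B. dense_subset T B \<and> partial_factorization G F B" if "finite F" "F \<subseteq> carrier G" for F
    using dense_finite_partial_factorization [OF tb inf that] by blast
  moreover have "\<exists>R. dense_subset T R \<and> factorization G H R"
    if "subgroup H G" "|rcosets\<^bsub>G\<^esub> H| =o |carrier G|" for H
    using dense_transversal [OF tb inf that(1) slender_subgroup [OF inf that]] by blast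
  moreover have "partially_box_resolvable G T |{..<n}|" for n :: nat
  proof -
    obtain F where F: "finite F" "card F = n" "F \<subseteq> carrier G"
      using infinite_arbitrarily_large [OF inf] by blast
    then have "|F| =o |{..<n}|"
      using card_of_ordIso finite_same_card_bij [of F "{..<n}"] by auto
    then show ?thesis
      unfolding partially_box_resolvable_def
      using dense_finite_partial_factorization [OF tb inf F(1,3)] by metis
  qed
  moreover have "box_resolvable G T \<kappa>"
    if \<kappa>: "Card_order \<kappa>" "cinfinite \<kappa>" "\<kappa> <o |carrier G|" for \<kappa> :: "'k rel"
  proof -
    have field: "|Field \<kappa>| =o \<kappa>"
      using \<kappa>(1) by (rule card_of_Field_ordIso)
    then have "|Field \<kappa>| \<le>o |carrier G|"
      by (rule ordLess_imp_ordLeq [OF ordIso_ordLess_trans [OF _ \<kappa>(3)]])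
    then have "\<exists>A\<subseteq>carrier G. |Field \<kappa>| =o |A| \<and> |A| \<le>o |carrier G|"
      by (rule internalize_card_of_ordLeq2 [THEN iffD1])
    then obtain A where A: "A \<subseteq> carrier G" "|Field \<kappa>| =o |A|"
      by auto
    then have "infinite A"
      using \<kappa>(2) card_of_ordIso_finite [OF A(2)] unfolding cinfinite_def by simp
    then obtain H where H: "subgroup H G" "|H| =o |A|"
      using subgroup_of_infinite_cardinality A(1) by metis
    have H\<kappa>: "|H| =o \<kappa>"
      using ordIso_transitive [OF H(2) ordIso_transitive [OF ordIso_symmetric [OF A(2)] field]] .
    have "slender H"
      by (rule slender_of_card_less [OF inf subgroup.subset [OF H(1)]
            ordIso_ordLess_trans [OF H\<kappa> \<kappa>(3)]])
    then obtain R where "dense_subset T R" "factorization G H R"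
      using dense_transversal [OF tb inf H(1)] by blast
    then show ?thesis
      unfolding box_resolvable_def using H\<kappa> by blast
  qed
  ultimately show ?thesis
    by blast
qed

end
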